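(* Let $V$ be a finite dimensional real vector space endowed with its canonical affine connection $\nabla$. Let $\bullet$ be a commutative (bilinear) product on $V^*$ and $B$ a symmetric bilinear form on $V^*$, and let $h$ be the affine symmetric bivector field on $V$ determined by $$h(\alpha,\beta)(u)=\langle\alpha\bullet\beta,u\rangle+B(\alpha,\beta),\qquad \alpha,\beta\in V^*\subset\Omega^1(V),\ u\in V.$$ Then $(V,\nabla,h)$ is a contravariant pseudo-Hessian manifold if and only if $\bullet$ is associative and $B$ is a scalar 2-cocycle of $(V^*,\bullet)$, i.e. $B(\alpha\bullet\beta,\gamma)=B(\alpha,\beta\bullet\gamma)$ for all $\alpha,\beta,\gamma\in V^*$.
   Context: Elements of $V^*$ are viewed as constant 1-forms on $V$. For a symmetric bivector field $h$ (a symmetric bilinear form on 1-forms), $h_\#$ is defined by $\beta(h_\#(\alpha))=h(\alpha,\beta)$. $(V,\nabla,h)$ is a contravariant pseudo-Hessian manifold if $(\nabla_{h_\#(\alpha)}h)(\beta,\gamma)=(\nabla_{h_\#(\beta)}h)(\alpha,\gamma)$ for all $\alpha,\beta,\gamma\in\Omega^1(V)$. *)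

theory Defs
  imports "HOL-Analysis.Analysis"
begin

text \<open>
  A finite-dimensional real vector space \<open>V\<close> is a type of class \<^class>\<open>real_normed_vector\<close> with a
  finite spanning set (assumed in the theorem).  All norms on \<open>V\<close> are equivalent, so the norm only
  provides the canonical topology needed for derivatives.  The class \<^class>\<open>euclidean_space\<close> is
  avoided because it excludes the zero space and fixes an inner product.

  In finite dimension every linear functional is bounded, so \<open>V\<^sup>*\<close> is the type of bounded linear
  maps \<open>V \<rightarrow> \<real>\<close>.  The tangent spaces of \<open>V\<close> are identified with \<open>V\<close>.
\<close>

type_synonym 'v dual = "'v \<Rightarrow>\<^sub>L real"
type_synonym 'v vector_field = "'v \<Rightarrow> 'v"
type_synonym 'v one_form = "'v \<Rightarrow> 'v dual"
type_synonym 'v bivector_field = "'v \<Rightarrow> 'v dual \<Rightarrow> 'v dual \<Rightarrow> real"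

text \<open>
  For a finite-dimensional domain this is the usual class \<open>C\<^sup>k\<close>: differentiable maps whose
  derivatives in each fixed direction are continuous are exactly the \<open>C\<^sup>1\<close> maps.
\<close>

primrec Ck :: "nat \<Rightarrow> ('a::real_normed_vector \<Rightarrow> 'b::real_normed_vector) \<Rightarrow> bool" where
  "Ck 0 f \<longleftrightarrow> continuous_on UNIV f"
| "Ck (Suc k) f \<longleftrightarrow>
     (\<forall>x. f differentiable (at x)) \<and> (\<forall>v. Ck k (\<lambda>x. frechet_derivative f (at x) v))"

definition smooth :: "('a::real_normed_vector \<Rightarrow> 'b::real_normed_vector) \<Rightarrow> bool" where
  "smooth f \<longleftrightarrow> (\<forall>k. Ck k f)"

definition symmetric_bivector_field :: "('v::real_normed_vector) bivector_field \<Rightarrow> bool" where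
  "symmetric_bivector_field h \<longleftrightarrow>
     (\<forall>u. bilinear (h u) \<and> (\<forall>\<alpha> \<beta>. h u \<alpha> \<beta> = h u \<beta> \<alpha>)) \<and>
     (\<forall>\<alpha> \<beta>. smooth (\<lambda>u. h u \<alpha> \<beta>))"

definition bivector_eval ::
  "('v::real_normed_vector) bivector_field \<Rightarrow> 'v one_form \<Rightarrow> 'v one_form \<Rightarrow> 'v \<Rightarrow> real" where
  "bivector_eval h \<alpha> \<beta> = (\<lambda>u. h u (\<alpha> u) (\<beta> u))"

text \<open>The vector is unique, and in finite dimension it exists because \<open>V\<close> is reflexive.\<close>

definition sharp ::
  "('v::real_normed_vector) bivector_field \<Rightarrow> 'v one_form \<Rightarrow> 'v vector_field" where
  "sharp h \<alpha> = (\<lambda>u. THE x. \<forall>\<beta>. blinfun_apply \<beta> x = h u (\<alpha> u) \<beta>)"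

text \<open>
  For \<open>W = \<real>\<close> this is the action \<open>X f\<close> of a vector field on a function; for \<open>W = V\<close> it is
  \<open>\<nabla>\<^sub>X Y\<close> for the canonical affine connection \<open>\<nabla>\<close>.
\<close>

definition deriv_along ::
  "('v::real_normed_vector) vector_field \<Rightarrow> ('v \<Rightarrow> 'w::real_normed_vector) \<Rightarrow> 'v \<Rightarrow> 'w" where
  "deriv_along X f = (\<lambda>u. frechet_derivative f (at u) (X u))"

abbreviation nabla ::
  "('v::real_normed_vector) vector_field \<Rightarrow> 'v vector_field \<Rightarrow> 'v vector_field" where
  "nabla X Y \<equiv> deriv_along X Y"

text \<open>
  The connection induced on 1-forms, \<open>(\<nabla>\<^sub>X \<beta>)(Y) = X (\<beta>(Y)) - \<beta>(\<nabla>\<^sub>X Y)\<close>.  The right-hand side is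
  tensorial in \<open>Y\<close>, so constant fields \<open>Y\<close> suffice to determine \<open>\<nabla>\<^sub>X \<beta>\<close>.
\<close>

definition nabla_one_form ::
  "('v::real_normed_vector) vector_field \<Rightarrow> 'v one_form \<Rightarrow> 'v one_form" where
  "nabla_one_form X \<beta> = (\<lambda>u. Blinfun (\<lambda>y.
     deriv_along X (\<lambda>x. blinfun_apply (\<beta> x) y) u - blinfun_apply (\<beta> u) (nabla X (\<lambda>_. y) u)))"

definition nabla_bivector ::
  "('v::real_normed_vector) vector_field \<Rightarrow> 'v bivector_field
     \<Rightarrow> 'v one_form \<Rightarrow> 'v one_form \<Rightarrow> 'v \<Rightarrow> real" where
  "nabla_bivector X h \<beta> \<gamma> = (\<lambda>u.
     deriv_along X (bivector_eval h \<beta> \<gamma>) u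
     - bivector_eval h (nabla_one_form X \<beta>) \<gamma> u
     - bivector_eval h \<beta> (nabla_one_form X \<gamma>) u)"

text \<open>The connection is always the canonical one of \<open>V\<close>, hence not a parameter.\<close>

definition contravariant_pseudo_Hessian :: "('v::real_normed_vector) bivector_field \<Rightarrow> bool" where
  "contravariant_pseudo_Hessian h \<longleftrightarrow>
     symmetric_bivector_field h \<and>
     (\<forall>\<alpha> \<beta> \<gamma> :: 'v one_form. smooth \<alpha> \<longrightarrow> smooth \<beta> \<longrightarrow> smooth \<gamma> \<longrightarrow>
        nabla_bivector (sharp h \<alpha>) h \<beta> \<gamma> = nabla_bivector (sharp h \<beta>) h \<alpha> \<gamma>)"

end

theory Submission
  imports Defs
begin

text \<open>
  Tensoriality gives \<open>(\<nabla>\<^sub>X h)(\<beta>, \<gamma>) = \<langle>\<beta> \<bullet> \<gamma>, X\<rangle>\<close>, so the Hessian condition says that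
  \<open>\<langle>\<alpha> \<bullet> (\<beta> \<bullet> \<gamma>), u\<rangle> + B(\<alpha>, \<beta> \<bullet> \<gamma>)\<close> is symmetric in \<open>\<alpha>\<close> and \<open>\<beta>\<close> at every point \<open>u\<close>.  At \<open>u = 0\<close>
  this is the condition on \<open>B\<close>; what remains is the one on \<open>\<bullet>\<close>, and commutativity turns both into
  the stated identities.  Differentiating \<open>\<beta> \<bullet> \<gamma>\<close> needs \<open>\<bullet>\<close> to be continuous, and \<open>h\<^sub>#\<close> exists because
  coordinate functionals are continuous; both hold since subspaces of \<open>V\<close> are closed.
\<close>

section \<open>Finitely spanned subspaces are complete, hence closed\<close>

text \<open>The closed subspace \<open>span T\<close> lies at positive distance from
  \<open>a\<close>, so the coefficient along \<open>a\<close> is controlled by the norm. A Cauchy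
  sequence therefore splits into a Cauchy sequence of coefficients and one in \<open>span T\<close>,
  and both limits exist.\<close>

lemma complete_insert_span:
  fixes a :: "'a::real_normed_vector"
  assumes T: "complete (span T)" and a: "a \<notin> span T"
  shows "complete (span (insert a T))"
proof (rule completeI)
  fix f :: "nat \<Rightarrow> 'a"
  assume f_in: "\<forall>n. f n \<in> span (insert a T)" and "Cauchy f"
  from f_in have "\<forall>n. \<exists>k. f n - k *\<^sub>R a \<in> span T"
    by (auto simp: span_breakdown_eq)
  then obtain c where c: "f n - c n *\<^sub>R a \<in> span T" for n by metis
  define d where "d = infdist a (span T)"
  have "closed (span T)" using T by (rule complete_imp_closed)
  then have "d > 0" unfolding d_def
    using a span_zero infdist_pos_not_in_closed by blast
  have coord_bound: "\<bar>k\<bar> * d \<le> norm y" if "y - k *\<^sub>R a \<in> span T" for k y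
  proof (cases "k = 0")
    case False
    \<comment> \<open>This element of \<open>span T\<close> equals \<open>a - y / k\<close>, so its
      distance from \<open>a\<close> is \<open>norm y / \<bar>k\<bar>\<close>.\<close>
    have "- ((1 / k) *\<^sub>R (y - k *\<^sub>R a)) \<in> span T"
      using that by (intro span_neg span_scale)
    then have "d \<le> dist a (- ((1 / k) *\<^sub>R (y - k *\<^sub>R a)))"
      unfolding d_def by (rule infdist_le)
    also have "\<dots> = norm y / \<bar>k\<bar>"
      using False by (simp add: dist_norm scaleR_diff_right divide_inverse)
    finally show ?thesis using False by (simp add: field_simps)
  qed auto
  have diff: "(f m - f n) - (c m - c n) *\<^sub>R a \<in> span T" for m n
    using span_diff[OF c[of m] c[of n]] by (simp add: algebra_simps)
  have "Cauchy c"
  proof (rule metric_CauchyI)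
    fix e :: real assume "e > 0"
    then obtain M where M: "\<And>m n. m \<ge> M \<Longrightarrow> n \<ge> M \<Longrightarrow> dist (f m) (f n) < e * d"
      using metric_CauchyD[OF \<open>Cauchy f\<close>, of "e * d"] \<open>d > 0\<close> by auto
    have "dist (c m) (c n) < e" if "m \<ge> M" "n \<ge> M" for m n
    proof -
      have "dist (c m) (c n) * d < e * d"
        using le_less_trans[OF coord_bound[OF diff[of m n]]] M[OF that]
        by (simp add: dist_norm)
      then show ?thesis using \<open>d > 0\<close> by simp
    qed
    then show "\<exists>M. \<forall>m\<ge>M. \<forall>n\<ge>M. dist (c m) (c n) < e" by blast
  qed
  then obtain k where k: "c \<longlonglongrightarrow> k" by (auto simp: Cauchy_convergent_iff convergent_def)
  then have ka: "(\<lambda>n. c n *\<^sub>R a) \<longlonglongrightarrow> k *\<^sub>R a" by (intro tendsto_intros)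
  have "Cauchy (\<lambda>n. f n - c n *\<^sub>R a)"
  proof (rule metric_CauchyI)
    fix e :: real assume "e > 0"
    obtain M where M: "\<And>m n. m \<ge> M \<Longrightarrow> n \<ge> M \<Longrightarrow> dist (f m) (f n) < e / 2"
      using metric_CauchyD[OF \<open>Cauchy f\<close>, of "e / 2"] \<open>e > 0\<close> by auto
    obtain N where N: "\<And>m n. m \<ge> N \<Longrightarrow> n \<ge> N \<Longrightarrow> dist (c m *\<^sub>R a) (c n *\<^sub>R a) < e / 2"
      using metric_CauchyD[OF LIMSEQ_imp_Cauchy[OF ka], of "e / 2"] \<open>e > 0\<close> by auto
    have "dist (f m - c m *\<^sub>R a) (f n - c n *\<^sub>R a) < e" if "m \<ge> max M N" "n \<ge> max M N" for m n
    proof -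
      have "dist (f m - c m *\<^sub>R a) (f n - c n *\<^sub>R a)
          \<le> dist (f m) (f n) + dist (c m *\<^sub>R a) (c n *\<^sub>R a)"
        using norm_triangle_ineq4[of "f m - f n" "c m *\<^sub>R a - c n *\<^sub>R a"]
        unfolding dist_norm by (simp only: diff_diff_eq2 diff_diff_eq add_diff_eq diff_add_eq add.commute)
      then show ?thesis using M[of m n] N[of m n] that by simp
    qed
    then show "\<exists>M. \<forall>m\<ge>M. \<forall>n\<ge>M. dist (f m - c m *\<^sub>R a) (f n - c n *\<^sub>R a) < e" by blast
  qed
  then obtain l where l: "l \<in> span T" "(\<lambda>n. f n - c n *\<^sub>R a) \<longlonglongrightarrow> l"
    using completeE[of "span T" "\<lambda>n. f n - c n *\<^sub>R a"] T c by auto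
  have "f \<longlonglongrightarrow> l + k *\<^sub>R a"
    using tendsto_add[OF l(2) ka] by simp
  moreover have "l + k *\<^sub>R a \<in> span (insert a T)"
    using l(1) by (auto simp: span_breakdown_eq intro!: exI[of _ k])
  ultimately show "\<exists>l\<in>span (insert a T). f \<longlonglongrightarrow> l" by blast
qed

lemma closed_span_finite:
  fixes S :: "'a::real_normed_vector set"
  assumes "finite S"
  shows "closed (span S)"
proof -
  from assms have "complete (span S)"
  proof induction
    case (insert a T)
    then show ?case
      using complete_insert_span[of T a] span_redundant[of a T] by (cases "a \<in> span T") auto
  qed (simp add: span_empty finite_imp_compact compact_imp_complete)
  then show ?thesis by (rule complete_imp_closed)
qed

section \<open>Continuity of linear and bilinear maps in finite dimension\<close>

text \<open>The kernel of a nonzero functional is finitely spanned, hence closed. If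
  \<open>f v = 1\<close> and \<open>d\<close> is the distance from \<open>v\<close> to the kernel,
  then \<open>1 / d\<close> bounds \<open>f\<close>.\<close>

lemma bounded_linear_functional_finite_dim:
  fixes f :: "'a::real_normed_vector \<Rightarrow> real" and S :: "'a set"
  assumes "finite S" "span S = UNIV" "linear f"
  shows "bounded_linear f"
proof (cases "\<exists>x. f x \<noteq> 0")
  case True
  then obtain x where x: "f x \<noteq> 0" by blast
  define v where "v = (1 / f x) *\<^sub>R x"
  have fv: "f v = 1" using x by (simp add: v_def linear_cmul[OF assms(3)])
  define P where "P = (\<lambda>y. y - f y *\<^sub>R v)"
  have "linear P"
    unfolding P_def using assms(3)
    by (intro linearI) (simp_all add: linear_add linear_cmul algebra_simps)
  then have ran: "span (P ` S) = range P"
    using linear_span_image[of P S] assms(2) by simp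
  define d where "d = infdist v (range P)"
  have "f (P y) = 0" for y
    using fv by (simp add: P_def linear_diff[OF assms(3)] linear_cmul[OF assms(3)])
  then have "v \<notin> range P" using fv by (metis imageE zero_neq_one)
  moreover have "closed (range P)"
    using closed_span_finite[of "P ` S"] assms(1) ran by simp
  ultimately have "d > 0"
    unfolding d_def using infdist_pos_not_in_closed[of "range P" v] by simp
  have "norm (f y) \<le> norm y * (1 / d)" for y
  proof (cases "f y = 0")
    case False
    \<comment> \<open>Dividing \<open>y\<close> by \<open>f y\<close> makes its value under
      \<open>f\<close> equal to that of \<open>v\<close>, so the difference lies in the
      kernel.\<close>
    have "v - (1 / f y) *\<^sub>R y = P (- (1 / f y) *\<^sub>R y)"
      using False by (simp add: P_def linear_neg[OF assms(3)] linear_cmul[OF assms(3)])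
    then have "d \<le> dist v (v - (1 / f y) *\<^sub>R y)"
      unfolding d_def by (simp add: infdist_le)
    also have "\<dots> = norm y / \<bar>f y\<bar>" by (simp add: dist_norm divide_inverse)
    finally show ?thesis using False \<open>d > 0\<close> by (simp add: field_simps)
  qed (use \<open>d > 0\<close> in simp)
  then show ?thesis
    using assms(3) by (intro bounded_linear_intro[where K = "1 / d"])
      (auto simp: linear_add linear_cmul)
next
  case False
  then have "f = (\<lambda>_. 0)" by auto
  then show ?thesis by simp
qed

lemma finite_basis_exists:
  fixes S :: "'a::real_normed_vector set"
  assumes "finite S" "span S = UNIV"
  obtains D :: "'a set" where "finite D" "independent D" "span D = UNIV"
proof -
  obtain D where D: "D \<subseteq> S" "independent D" "S \<subseteq> span D"
    using maximal_independent_subset[of S] by blast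
  then have "span D = UNIV" using assms(2) span_mono[of S "span D"] by (auto simp: span_span)
  with D that assms(1) show thesis by (meson finite_subset)
qed

lemma linear_representation_UNIV:
  assumes "independent D" "span D = UNIV"
  shows "linear (\<lambda>x. representation D x b)"
  using assms by (intro linearI) (simp_all add: representation_add representation_scale)

lemma linear_basis_expansion:
  fixes f :: "'a::real_vector \<Rightarrow> 'b::real_vector" and D :: "'a set"
  assumes "finite D" "independent D" "span D = UNIV" "linear f"
  shows "f x = (\<Sum>b\<in>D. representation D x b *\<^sub>R f b)"
proof -
  have "f x = f (\<Sum>b\<in>D. representation D x b *\<^sub>R b)"
    using assms sum_representation_eq[of D x D] by simp
  then show ?thesis using assms(4) by (simp add: linear_sum linear_cmul)
qed

text \<open>In a basis, \<open>f\<close> is a finite sum of continuous coordinate functionals times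
  fixed vectors.\<close>

lemma bounded_linear_finite_dim:
  fixes f :: "'a::real_normed_vector \<Rightarrow> 'b::real_normed_vector" and S :: "'a set"
  assumes "finite S" "span S = UNIV" "linear f"
  shows "bounded_linear f"
proof -
  obtain D :: "'a set" where D: "finite D" "independent D" "span D = UNIV"
    using finite_basis_exists[OF assms(1,2)] .
  have "bounded_linear (\<lambda>x. representation D x b)" for b
    using bounded_linear_functional_finite_dim[OF D(1,3) linear_representation_UNIV[OF D(2,3)]] .
  then have "bounded_linear (\<lambda>x. \<Sum>b\<in>D. representation D x b *\<^sub>R f b)"
    by (intro bounded_linear_sum bounded_linear_scaleR_const)
  moreover have "(\<lambda>x. \<Sum>b\<in>D. representation D x b *\<^sub>R f b) = f"
    by (intro ext linear_basis_expansion[OF D assms(3), symmetric])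
  ultimately show ?thesis by simp
qed

text \<open>Expanding only the first argument in a basis suffices: each slice \<open>g b\<close> is
  already a bounded linear map, and the bounds \<open>K b * L b\<close> add up.\<close>

lemma bounded_bilinear_finite_dim:
  fixes g :: "'a::real_normed_vector \<Rightarrow> 'b::real_normed_vector \<Rightarrow> 'c::real_normed_vector"
    and S :: "'a set" and T :: "'b set"
  assumes S: "finite S" "span S = UNIV" and T: "finite T" "span T = UNIV" and g: "bilinear g"
  shows "bounded_bilinear g"
proof -
  obtain D :: "'a set" where D: "finite D" "independent D" "span D = UNIV"
    using finite_basis_exists[OF S] .
  have "bounded_linear (\<lambda>x. representation D x b)" for b
    using bounded_linear_functional_finite_dim[OF D(1,3) linear_representation_UNIV[OF D(2,3)]] .
  then have "\<exists>K. \<forall>x. \<bar>representation D x b\<bar> \<le> norm x * K" for b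
    using bounded_linear.bounded by fastforce
  then obtain K where K: "\<bar>representation D x b\<bar> \<le> norm x * K b" for x b by metis
  have "bounded_linear (g b)" for b
    using bounded_linear_finite_dim[OF T, of "g b"] g by (simp add: bilinear_def)
  then have "\<exists>L. \<forall>y. norm (g b y) \<le> norm y * L" for b
    using bounded_linear.bounded by blast
  then obtain L where L: "norm (g b y) \<le> norm y * L b" for b y by metis
  show ?thesis
  proof
    show "\<exists>M. \<forall>x y. norm (g x y) \<le> norm x * norm y * M"
    proof (intro exI allI)
      fix x y
      have "g x y = (\<Sum>b\<in>D. representation D x b *\<^sub>R g b y)"
        using linear_basis_expansion[OF D, of "\<lambda>x. g x y" x] g by (simp add: bilinear_def)
      also have "norm \<dots> \<le> (\<Sum>b\<in>D. (norm x * K b) * (norm y * L b))"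
        by (intro sum_norm_le)
          (auto intro!: mult_mono K L order_trans[OF abs_ge_zero K])
      also have "\<dots> = norm x * norm y * (\<Sum>b\<in>D. K b * L b)"
        by (simp add: sum_distrib_left algebra_simps)
      finally show "norm (g x y) \<le> norm x * norm y * (\<Sum>b\<in>D. K b * L b)" .
    qed
  qed (use g in \<open>simp_all add: bilinear_ladd bilinear_radd bilinear_lmul bilinear_rmul\<close>)
qed

section \<open>Dual bases and the existence of \<open>h_#\<close>\<close>

text \<open>The \<open>e b\<close> are the coordinate functionals of a basis; their continuity
  places them in the dual.\<close>

lemma dual_basis_exists:
  fixes S :: "'v::real_normed_vector set"
  assumes "finite S" "span S = UNIV"
  obtains D :: "'v set" and e :: "'v \<Rightarrow> 'v dual"
  where "finite D" "\<And>\<phi> :: 'v dual. (\<Sum>b\<in>D. blinfun_apply \<phi> b *\<^sub>R e b) = \<phi>"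
    "\<And>x. (\<Sum>b\<in>D. blinfun_apply (e b) x *\<^sub>R b) = x"
proof -
  obtain D :: "'v set" where D: "finite D" "independent D" "span D = UNIV"
    using finite_basis_exists[OF assms] .
  define e where "e b = Blinfun (\<lambda>x. representation D x b)" for b
  have "bounded_linear (\<lambda>x. representation D x b)" for b
    using bounded_linear_functional_finite_dim[OF D(1,3) linear_representation_UNIV[OF D(2,3)]] .
  then have e: "blinfun_apply (e b) x = representation D x b" for b x
    by (simp add: e_def bounded_linear_Blinfun_apply)
  show thesis
  proof (rule that[OF D(1)])
    fix \<phi> :: "'v dual"
    show "(\<Sum>b\<in>D. blinfun_apply \<phi> b *\<^sub>R e b) = \<phi>"
    proof (rule blinfun_eqI)
      fix x
      show "blinfun_apply (\<Sum>b\<in>D. blinfun_apply \<phi> b *\<^sub>R e b) x = blinfun_apply \<phi> x"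
        using linear_basis_expansion[OF D, of "blinfun_apply \<phi>" x]
        by (simp add: e blinfun.sum_left blinfun.scaleR_left mult.commute
            bounded_linear.linear[OF blinfun.bounded_linear_right])
    qed
    show "(\<Sum>b\<in>D. blinfun_apply (e b) x *\<^sub>R b) = x" for x
      using linear_basis_expansion[OF D linear_id, of x] by (simp add: e)
  qed
qed

lemma finite_dim_dual:
  fixes S :: "'v::real_normed_vector set"
  assumes "finite S" "span S = UNIV"
  obtains T :: "'v dual set" where "finite T" "span T = UNIV"
proof -
  obtain D :: "'v set" and e :: "'v \<Rightarrow> 'v dual" where D: "finite D"
    and \<phi>: "\<And>\<phi> :: 'v dual. (\<Sum>b\<in>D. blinfun_apply \<phi> b *\<^sub>R e b) = \<phi>"
    by (rule dual_basis_exists[OF assms]) blast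
  have "(\<Sum>b\<in>D. blinfun_apply \<phi> b *\<^sub>R e b) \<in> span (e ` D)" for \<phi> :: "'v dual"
    by (intro span_sum span_scale span_base imageI)
  then have "span (e ` D) = UNIV" unfolding \<phi> by blast
  with D that show thesis by blast
qed

text \<open>This discharges the definite description in \<open>sharp\<close>: a dual basis yields
  both the representing vector and its uniqueness.\<close>

lemma apply_sharp:
  fixes h :: "'v::real_normed_vector bivector_field"
  assumes "finite S" "span S = (UNIV :: 'v set)" and lin: "linear (h u (\<alpha> u))"
  shows "blinfun_apply \<beta> (sharp h \<alpha> u) = h u (\<alpha> u) \<beta>"
proof -
  obtain D :: "'v set" and e :: "'v \<Rightarrow> 'v dual" where D: "finite D"
    and \<phi>: "\<And>\<phi> :: 'v dual. (\<Sum>b\<in>D. blinfun_apply \<phi> b *\<^sub>R e b) = \<phi>"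
    and x: "\<And>x. (\<Sum>b\<in>D. blinfun_apply (e b) x *\<^sub>R b) = x"
    by (rule dual_basis_exists[OF assms(1,2)]) blast
  \<comment> \<open>Testing against \<open>e b\<close> forces the coordinate of the vector along
    \<open>b\<close>.\<close>
  let ?x = "\<Sum>b\<in>D. h u (\<alpha> u) (e b) *\<^sub>R b"
  have ex: "blinfun_apply \<beta> ?x = h u (\<alpha> u) \<beta>" for \<beta>
  proof -
    have "h u (\<alpha> u) \<beta> = h u (\<alpha> u) (\<Sum>b\<in>D. blinfun_apply \<beta> b *\<^sub>R e b)"
      by (simp only: \<phi>)
    also have "\<dots> = blinfun_apply \<beta> ?x"
      using lin by (simp add: linear_sum linear_cmul blinfun.sum_right blinfun.scaleR_right
          mult.commute)
    finally show ?thesis by simp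
  qed
  have "y = ?x" if "\<forall>\<beta>. blinfun_apply \<beta> y = h u (\<alpha> u) \<beta>" for y
    using x[of y] that by simp
  then have "sharp h \<alpha> u = ?x"
    unfolding sharp_def using ex by (intro the_equality) auto
  then show ?thesis using ex by simp
qed

section \<open>Smoothness and covariant derivatives in the flat connection\<close>

lemma smooth_const: "smooth (\<lambda>_. c)"
proof -
  \<comment> \<open>The constant is generalised because differentiation replaces \<open>c\<close> by
    0.\<close>
  have "Ck k (\<lambda>_::'a. c :: 'b)" for k c by (induction k arbitrary: c) simp_all
  then show ?thesis by (simp add: smooth_def)
qed

lemma smooth_affine:
  fixes f :: "'a::real_normed_vector \<Rightarrow> 'b::real_normed_vector"
  assumes "bounded_linear f"
  shows "smooth (\<lambda>x. f x + c)"
proof -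
  have d: "((\<lambda>x. f x + c) has_derivative f) (at x)" for x
    using has_derivative_add[OF bounded_linear_imp_has_derivative[OF assms] has_derivative_const]
    by simp
  have "Ck k (\<lambda>x. f x + c)" for k
  proof (cases k)
    case 0
    then show ?thesis
      using assms by (simp add: continuous_on_add linear_continuous_on)
  next
    case (Suc j)
    have "frechet_derivative (\<lambda>x. f x + c) (at x) = f" for x
      using frechet_derivative_at[OF d] by simp
    moreover have "(\<lambda>x. f x + c) differentiable (at x)" for x
      using d differentiableI by blast
    \<comment> \<open>In a fixed direction \<open>v\<close> the derivative does not depend on the
      base point.\<close>
    moreover have "Ck j (\<lambda>_::'a. f v)" for v
      using smooth_const unfolding smooth_def by blast
    ultimately show ?thesis using Suc by simp
  qed
  then show ?thesis by (simp add: smooth_def)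
qed

lemma smooth_has_derivative:
  assumes "smooth f"
  shows "(f has_derivative frechet_derivative f (at x)) (at x)"
proof -
  have "Ck (Suc 0) f" using assms unfolding smooth_def by blast
  then show ?thesis by (simp flip: frechet_derivative_works)
qed

text \<open>Constant vector fields are parallel, so the correction term vanishes and only the
  componentwise derivative of the form remains.\<close>

lemma nabla_one_form_eq_deriv_along:
  assumes "(\<beta> has_derivative \<beta>') (at u)"
  shows "nabla_one_form X \<beta> u = \<beta>' (X u)"
proof -
  have "((\<lambda>x. blinfun_apply (\<beta> x) y) has_derivative (\<lambda>v. blinfun_apply (\<beta>' v) y)) (at u)" for y
    using assms by (auto intro!: derivative_eq_intros)
  then have "deriv_along X (\<lambda>x. blinfun_apply (\<beta> x) y) u = blinfun_apply (\<beta>' (X u)) y" for y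
    unfolding deriv_along_def by (subst frechet_derivative_at[symmetric]) auto
  then show ?thesis
    by (simp add: nabla_one_form_def deriv_along_def blinfun_apply_inverse)
qed

text \<open>
  The derivatives of \<open>\<beta>\<close> and \<open>\<gamma>\<close> cancel by the Leibniz rule, so only the linear part of \<open>h\<close>
  is differentiated.
\<close>

lemma nabla_bivector_affine:
  fixes mult :: "'v::real_normed_vector dual \<Rightarrow> 'v dual \<Rightarrow> 'v dual"
  assumes "bounded_bilinear mult" "bounded_bilinear B"
    and h: "\<And>u \<alpha> \<beta>. h u \<alpha> \<beta> = blinfun_apply (mult \<alpha> \<beta>) u + B \<alpha> \<beta>"
    and "smooth \<beta>" "smooth \<gamma>"
  shows "nabla_bivector X h \<beta> \<gamma> u = blinfun_apply (mult (\<beta> u) (\<gamma> u)) (X u)"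
proof -
  obtain \<beta>' \<gamma>' where d: "(\<beta> has_derivative \<beta>') (at u)" "(\<gamma> has_derivative \<gamma>') (at u)"
    using assms(4,5) smooth_has_derivative by blast
  \<comment> \<open>The three summands come from moving the evaluation point, from the product rule
    for \<open>mult\<close>, and from the product rule for \<open>B\<close>.\<close>
  have "(bivector_eval h \<beta> \<gamma> has_derivative
     (\<lambda>v. blinfun_apply (mult (\<beta> u) (\<gamma> u)) v
        + blinfun_apply (mult (\<beta> u) (\<gamma>' v) + mult (\<beta>' v) (\<gamma> u)) u
        + (B (\<beta> u) (\<gamma>' v) + B (\<beta>' v) (\<gamma> u)))) (at u)"
    unfolding bivector_eval_def h
    by (rule has_derivative_add[OF bounded_bilinear.FDERIV[OF bounded_bilinear_blinfun_apply
            bounded_bilinear.FDERIV[OF assms(1) d] has_derivative_ident]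
          bounded_bilinear.FDERIV[OF assms(2) d]])
  then have "deriv_along X (bivector_eval h \<beta> \<gamma>) u = blinfun_apply (mult (\<beta> u) (\<gamma> u)) (X u)
        + blinfun_apply (mult (\<beta> u) (\<gamma>' (X u)) + mult (\<beta>' (X u)) (\<gamma> u)) u
        + (B (\<beta> u) (\<gamma>' (X u)) + B (\<beta>' (X u)) (\<gamma> u))"
    unfolding deriv_along_def by (simp flip: frechet_derivative_at)
  then show ?thesis
    unfolding nabla_bivector_def bivector_eval_def
    by (simp add: nabla_one_form_eq_deriv_along[OF d(1)] nabla_one_form_eq_deriv_along[OF d(2)]
        h blinfun.add_left)
qed

section \<open>From the Hessian condition to algebraic identities\<close>

theorem proposition4p1:
  fixes mult :: "('v::real_normed_vector) dual \<Rightarrow> 'v dual \<Rightarrow> 'v dual"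
    and B :: "'v dual \<Rightarrow> 'v dual \<Rightarrow> real"
    and h :: "'v bivector_field"
  assumes finite_dim: "\<exists>S :: 'v set. finite S \<and> span S = UNIV"
    and mult_bilinear: "bilinear mult"
    and mult_commute: "\<And>\<alpha> \<beta>. mult \<alpha> \<beta> = mult \<beta> \<alpha>"
    and B_bilinear: "bilinear B"
    and B_symmetric: "\<And>\<alpha> \<beta>. B \<alpha> \<beta> = B \<beta> \<alpha>"
    and h_eq: "\<And>u \<alpha> \<beta>. h u \<alpha> \<beta> = blinfun_apply (mult \<alpha> \<beta>) u + B \<alpha> \<beta>"
  shows "contravariant_pseudo_Hessian h \<longleftrightarrow>
    (\<forall>\<alpha> \<beta> \<gamma>. mult (mult \<alpha> \<beta>) \<gamma> = mult \<alpha> (mult \<beta> \<gamma>)) \<and>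
    (\<forall>\<alpha> \<beta> \<gamma>. B (mult \<alpha> \<beta>) \<gamma> = B \<alpha> (mult \<beta> \<gamma>))"
proof -
  obtain S :: "'v set" where S: "finite S" "span S = UNIV" using finite_dim by blast
  obtain T :: "'v dual set" where T: "finite T" "span T = UNIV" using finite_dim_dual[OF S] .
  \<comment> \<open>Both maps take covectors as arguments, so the spanning set used here is that of
    the dual.\<close>
  have mult_bb: "bounded_bilinear mult" and B_bb: "bounded_bilinear B"
    using bounded_bilinear_finite_dim[OF T T] mult_bilinear B_bilinear by blast+
  have h_bilinear: "bilinear (h u)" for u
    unfolding bilinear_def h_eq using mult_bilinear B_bilinear
    by (auto intro!: linearI simp: bilinear_ladd bilinear_radd bilinear_lmul bilinear_rmul
        blinfun.add_left blinfun.scaleR_left algebra_simps)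
  have "smooth (\<lambda>u. h u \<alpha> \<beta>)" for \<alpha> \<beta>
    unfolding h_eq by (intro smooth_affine blinfun.bounded_linear_right)
  then have field: "symmetric_bivector_field h"
    unfolding symmetric_bivector_field_def
    using h_bilinear by (auto simp: h_eq mult_commute B_symmetric)
  have sharp: "blinfun_apply \<phi> (sharp h \<alpha> u) = blinfun_apply (mult (\<alpha> u) \<phi>) u + B (\<alpha> u) \<phi>"
    for \<phi> \<alpha> u
    using apply_sharp[where h = h and u = u and \<alpha> = \<alpha> and \<beta> = \<phi>, OF S]
      h_bilinear[of u] by (simp add: bilinear_def flip: h_eq)
  \<comment> \<open>The covariant derivative pairs \<open>mult (\<beta> u) (\<gamma> u)\<close> with
    the sharp of \<open>\<alpha>\<close>, which is again a value of \<open>h\<close>.\<close>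
  have nabla: "nabla_bivector (sharp h \<alpha>) h \<beta> \<gamma> u =
      blinfun_apply (mult (\<alpha> u) (mult (\<beta> u) (\<gamma> u))) u + B (\<alpha> u) (mult (\<beta> u) (\<gamma> u))"
    if "smooth \<beta>" "smooth \<gamma>" for \<alpha> \<beta> \<gamma> u
    using nabla_bivector_affine[OF mult_bb B_bb h_eq that] by (simp add: sharp)
  show ?thesis
  proof
    assume hess: "contravariant_pseudo_Hessian h"
    have eq: "blinfun_apply (mult \<alpha> (mult \<beta> \<gamma>)) u + B \<alpha> (mult \<beta> \<gamma>) =
        blinfun_apply (mult \<beta> (mult \<alpha> \<gamma>)) u + B \<beta> (mult \<alpha> \<gamma>)" for \<alpha> \<beta> \<gamma> u
    proof -
      \<comment> \<open>Constant 1-forms realise every triple of covectors at every point.\<close>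
      have "nabla_bivector (sharp h (\<lambda>_. \<alpha>)) h (\<lambda>_. \<beta>) (\<lambda>_. \<gamma>) u =
          nabla_bivector (sharp h (\<lambda>_. \<beta>)) h (\<lambda>_. \<alpha>) (\<lambda>_. \<gamma>) u"
        using hess unfolding contravariant_pseudo_Hessian_def by (simp add: smooth_const)
      then show ?thesis by (simp add: nabla smooth_const)
    qed
    have B: "B \<alpha> (mult \<beta> \<gamma>) = B \<beta> (mult \<alpha> \<gamma>)" for \<alpha> \<beta> \<gamma>
      using eq[of \<alpha> \<beta> \<gamma> 0] by simp
    have m: "mult \<alpha> (mult \<beta> \<gamma>) = mult \<beta> (mult \<alpha> \<gamma>)" for \<alpha> \<beta> \<gamma>
      using eq B by (intro blinfun_eqI) (metis add_right_cancel)
    \<comment> \<open>Writing the product as juxtaposition, (\<alpha> \<beta>) \<gamma> = \<gamma>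
      (\<alpha> \<beta>) = \<alpha> (\<gamma> \<beta>) = \<alpha> (\<beta> \<gamma>), where the
      middle equality is \<open>m\<close>; the same chain with \<open>B\<close> as the outer
      operation gives the cocycle identity.\<close>
    show "(\<forall>\<alpha> \<beta> \<gamma>. mult (mult \<alpha> \<beta>) \<gamma> = mult \<alpha> (mult \<beta> \<gamma>)) \<and>
      (\<forall>\<alpha> \<beta> \<gamma>. B (mult \<alpha> \<beta>) \<gamma> = B \<alpha> (mult \<beta> \<gamma>))"
      using m B mult_commute B_symmetric by metis
  next
    assume assoc: "(\<forall>\<alpha> \<beta> \<gamma>. mult (mult \<alpha> \<beta>) \<gamma> = mult \<alpha> (mult \<beta> \<gamma>)) \<and>
      (\<forall>\<alpha> \<beta> \<gamma>. B (mult \<alpha> \<beta>) \<gamma> = B \<alpha> (mult \<beta> \<gamma>))"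
    \<comment> \<open>Regroup, swap \<alpha> and \<beta> inside the inner product, and regroup
      back.\<close>
    then have "mult \<alpha> (mult \<beta> \<gamma>) = mult \<beta> (mult \<alpha> \<gamma>)"
      and "B \<alpha> (mult \<beta> \<gamma>) = B \<beta> (mult \<alpha> \<gamma>)" for \<alpha> \<beta> \<gamma>
      using mult_commute by metis+
    \<comment> \<open>The formula \<open>nabla\<close> involves only the values of the forms at
      \<open>u\<close>, so the identities for covectors apply pointwise to arbitrary smooth
      forms.\<close>
    then show "contravariant_pseudo_Hessian h"
      unfolding contravariant_pseudo_Hessian_def using field by (auto simp: nabla fun_eq_iff)
  qed
qed

end
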